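(* Let $t\ge3$ and $q\ge t$, and let $\mathbb{L}$ be a linear set of pseudoregulus type in $\mathrm{PG}(1,q^t)$. Then the number of $q$-order sublines contained in $\mathbb{L}$ is \[\frac{\theta_{t-1}}{q+1}\left(\frac{\sum_{y\in\mathbb{F}_{q^t}\setminus\mathbb{F}_q}[\mathbb{F}_q(y):\mathbb{F}_q]}{q(q-1)}-\theta_{t-2}\right).\]
   Context: $\theta_s=(q^{s+1}-1)/(q-1)$. A set $\mathbb{L}\subseteq\mathrm{PG}(1,q^t)$ is a linear set of pseudoregulus type if it is projectively equivalent to $\{\langle(\lambda,\lambda^q)\rangle_{q^t}:\lambda\in\mathbb{F}_{q^t}^*\}$. A $q$-order subline of $\mathrm{PG}(1,q^t)$ is a set projectively equivalent to $\{\langle(a,b)\rangle_{q^t}: (a,b)\in\mathbb{F}_q^2\setminus\{(0,0)\}\}$. *)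

theory Defs
  imports
    "HOL-Library.Cardinality"
    "HOL-Algebra.Algebraic_Closure_Type"
    "HOL-Algebra.Generated_Fields"
    "HOL-Algebra.Finite_Extensions"
begin

text \<open>
  The field \<open>F\<close> of order \<open>q\<^sup>t\<close> is a type \<open>'a\<close> of class \<open>{field, finite}\<close> with
  \<open>CARD('a) = q ^ t\<close>. Notions of field theory are those of HOL-Algebra, taken in the ring record
  \<open>ring_of_type_algebra\<close> that carries the type class operations.
\<close>

definition theta :: "nat \<Rightarrow> nat \<Rightarrow> real" where
  "theta q s = (real q ^ (s + 1) - 1) / (real q - 1)"

text \<open>\<open>[K(y) : K]\<close>, the dimension over \<open>K\<close> of the subfield generated by \<open>K\<close> and \<open>y\<close>.\<close>

definition adjoin_degree :: "'a::field set \<Rightarrow> 'a \<Rightarrow> nat" where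
  "adjoin_degree K y =
     (THE n. ring.dimension (ring_of_type_algebra :: 'a ring) n K
               (generate_field (ring_of_type_algebra :: 'a ring) (insert y K)))"

text \<open>
  \<open>PG(1, F)\<close>: its points are the one-dimensional subspaces \<open>proj_point a b\<close> of \<open>F\<^sup>2\<close> with
  \<open>(a, b) \<noteq> (0, 0)\<close>.
\<close>

definition proj_point :: "'a::field \<Rightarrow> 'a \<Rightarrow> ('a \<times> 'a) set" where
  "proj_point a b = {(c * a, c * b) | c. True}"

definition proj_line :: "('a::field \<times> 'a) set set" where
  "proj_line = {proj_point a b | a b. (a, b) \<noteq> (0, 0)}"

definition lin_map :: "'a::field \<Rightarrow> 'a \<Rightarrow> 'a \<Rightarrow> 'a \<Rightarrow> 'a \<times> 'a \<Rightarrow> 'a \<times> 'a" where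
  "lin_map m11 m12 m21 m22 = (\<lambda>(x, y). (m11 * x + m12 * y, m21 * x + m22 * y))"

text \<open>
  Projective equivalence is taken under \<open>PGL(2, F)\<close>; an invertible matrix acts on a point, which
  is a subspace, by taking its image.
\<close>

definition proj_equivalent ::
    "('a::field \<times> 'a) set set \<Rightarrow> ('a \<times> 'a) set set \<Rightarrow> bool" where
  "proj_equivalent S T \<longleftrightarrow> S \<subseteq> proj_line \<and> T \<subseteq> proj_line \<and>
     (\<exists>m11 m12 m21 m22. m11 * m22 - m12 * m21 \<noteq> 0 \<and>
        T = (\<lambda>P. lin_map m11 m12 m21 m22 ` P) ` S)"

definition pseudoregulus_type :: "nat \<Rightarrow> ('a::field \<times> 'a) set set \<Rightarrow> bool" where
  "pseudoregulus_type q L \<longleftrightarrow>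
     proj_equivalent {proj_point x (x ^ q) | x. x \<noteq> 0} L"

text \<open>For \<open>K\<close> the subfield of order \<open>q\<close>, these are the \<open>q\<close>-order sublines.\<close>

definition subline :: "'a::field set \<Rightarrow> ('a \<times> 'a) set set \<Rightarrow> bool" where
  "subline K S \<longleftrightarrow>
     proj_equivalent {proj_point a b | a b. a \<in> K \<and> b \<in> K \<and> (a, b) \<noteq> (0, 0)} S"

end

theory Submission
  imports Defs
begin

text \<open>
  A subline \<open>f B\<close>, with \<open>f\<close> linear and \<open>B\<close> the standard subline, lies in the standard linear set
  \<open>{\<langle>(x, x\<^sup>q)\<rangle>}\<close> iff \<open>a s + b\<close> and \<open>c s + d\<close> have the same norm for all \<open>s \<in> K\<close>, and so do
  \<open>a\<close> and \<open>c\<close>. As \<open>t \<le> q\<close>, the two norms then agree as polynomials in \<open>s\<close>, so their roots are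
  conjugate: up to a scalar, \<open>f\<close> is \<open>s \<mapsto> u (s - y) / (s - y')\<close> with \<open>u\<close> of norm 1 and
  \<open>y' \<noteq> y\<close> a conjugate of \<open>y\<close>. There are \<open>\<theta>\<^sub>t\<^sub>-\<^sub>1 \<cdot> (\<Sum>y. [K(y) : K] - 1)\<close> of these, and each subline
  arises from \<open>|PGL(2, q)| = q (q\<^sup>2 - 1)\<close> of them.
\<close>

section \<open>Projective points and linear maps\<close>

lemma proj_point_eq_iff:
  fixes a b c d :: "'a::field"
  assumes "(a, b) \<noteq> (0, 0)" "(c, d) \<noteq> (0, 0)"
  shows "proj_point a b = proj_point c d \<longleftrightarrow> (\<exists>k. k \<noteq> 0 \<and> c = k * a \<and> d = k * b)"
proof
  assume eq: "proj_point a b = proj_point c d"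
  have "(c, d) \<in> proj_point c d" unfolding proj_point_def by (auto intro!: exI[of _ 1])
  then obtain k where "c = k * a" "d = k * b" using eq unfolding proj_point_def by blast
  then show "\<exists>k. k \<noteq> 0 \<and> c = k * a \<and> d = k * b" using assms by auto
next
  assume "\<exists>k. k \<noteq> 0 \<and> c = k * a \<and> d = k * b"
  then obtain k where k: "k \<noteq> 0" "c = k * a" "d = k * b" by blast
  show "proj_point a b = proj_point c d"
  proof (intro equalityI subsetI)
    fix p assume "p \<in> proj_point a b"
    then obtain l where "p = (l * a, l * b)" by (auto simp: proj_point_def)
    then have "p = (l / k * c, l / k * d)" using k by simp
    then show "p \<in> proj_point c d" unfolding proj_point_def by blast
  next
    fix p assume "p \<in> proj_point c d"
    then obtain l where "p = (l * c, l * d)" by (auto simp: proj_point_def)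
    then have "p = (l * k * a, l * k * b)" using k by simp
    then show "p \<in> proj_point a b" unfolding proj_point_def by blast
  qed
qed

lemma lin_map_image_proj_point:
  "lin_map a b c d ` proj_point x y = proj_point (a * x + b * y) (c * x + d * y)"
proof -
  have "lin_map a b c d (k * x, k * y) = (k * (a * x + b * y), k * (c * x + d * y))" for k
    by (simp add: lin_map_def algebra_simps)
  then show ?thesis unfolding proj_point_def by (force simp: image_iff)
qed

lemma lin_map_comp:
  "lin_map a b c d \<circ> lin_map a' b' c' d' =
    lin_map (a * a' + b * c') (a * b' + b * d') (c * a' + d * c') (c * b' + d * d')"
  by (auto simp: lin_map_def fun_eq_iff algebra_simps)

lemma lin_map_inject:
  "lin_map a b c d = lin_map a' b' c' d' \<longleftrightarrow> a = a' \<and> b = b' \<and> c = c' \<and> d = d'"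
proof
  assume eq: "lin_map a b c d = lin_map a' b' c' d'"
  show "a = a' \<and> b = b' \<and> c = c' \<and> d = d'"
    using fun_cong[OF eq, of "(1, 0)"] fun_cong[OF eq, of "(0, 1)"] by (simp add: lin_map_def)
qed simp

text \<open>Elements are functions on pairs and scalars are not factored out. Over the field of
  order \<open>q ^ t\<close> every projectivity is thus counted \<open>q ^ t - 1\<close> times, both
  in the stabilizer and among the maps into the pseudoregulus, and this factor cancels at the
  end.\<close>

definition GL2 :: "('a::field \<times> 'a \<Rightarrow> 'a \<times> 'a) set" where
  "GL2 = {lin_map a b c d | a b c d. a * d - b * c \<noteq> 0}"

lemma lin_map_in_GL2_iff: "lin_map a b c d \<in> GL2 \<longleftrightarrow> a * d - b * c \<noteq> 0"
  by (auto simp: GL2_def lin_map_inject)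

lemma GL2_comp: "f \<in> GL2 \<Longrightarrow> g \<in> GL2 \<Longrightarrow> f \<circ> g \<in> GL2"
proof -
  assume "f \<in> GL2" "g \<in> GL2"
  then obtain a b c d a' b' c' d' where fg: "f = lin_map a b c d" "g = lin_map a' b' c' d'"
    and det: "a * d - b * c \<noteq> 0" "a' * d' - b' * c' \<noteq> 0"
    unfolding GL2_def by blast
  have "(a * a' + b * c') * (c * b' + d * d') - (a * b' + b * d') * (c * a' + d * c') =
    (a * d - b * c) * (a' * d' - b' * c')" by (simp add: algebra_simps)
  then show "f \<circ> g \<in> GL2" unfolding GL2_def fg lin_map_comp using det by force
qed

lemma GL2_inverse:
  assumes "f \<in> GL2"
  obtains g where "g \<in> GL2" "f \<circ> g = id" "g \<circ> f = id"
proof -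
  obtain a b c d where f: "f = lin_map a b c d" and det: "a * d - b * c \<noteq> 0"
    using assms unfolding GL2_def by blast
  define e where "e = a * d - b * c"
  have e: "e \<noteq> 0" using det e_def by simp
  let ?g = "lin_map (d / e) (- b / e) (- c / e) (a / e)"
  have "d / e * (a / e) - (- b / e) * (- c / e) = (a * d - b * c) / (e * e)"
    by (simp add: diff_divide_distrib mult.commute)
  then have "?g \<in> GL2" unfolding GL2_def using e det by force
  moreover have id: "id = lin_map 1 0 0 (1 :: 'a)" by (auto simp: lin_map_def fun_eq_iff)
  have "f \<circ> ?g = id" "?g \<circ> f = id"
    unfolding f id lin_map_comp lin_map_inject using e
    by (simp_all add: field_simps) (simp_all add: e_def algebra_simps)
  ultimately show ?thesis using that by blast
qed

section \<open>The action on sets of points and the orbit count\<close>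

definition act :: "('a \<Rightarrow> 'a) \<Rightarrow> 'a set set \<Rightarrow> 'a set set" where
  "act f S = (\<lambda>P. f ` P) ` S"

lemma act_comp: "act (f \<circ> g) S = act f (act g S)"
  by (simp add: act_def image_comp comp_def)

lemma act_id: "act id S = S"
  by (simp add: act_def)

lemma act_mono: "S \<subseteq> T \<Longrightarrow> act f S \<subseteq> act f T"
  by (auto simp: act_def)

lemma inj_act_point: "f \<in> GL2 \<Longrightarrow> inj (\<lambda>P. f ` P)"
  by (metis GL2_inverse inj_image_eq_iff inj_on_id inj_on_imageI2 injI)

text \<open>Applying the adjugate matrix to the image returns (x, y) times the determinant, so a
  zero image forces a zero vector.\<close>

lemma lin_map_nonzero:
  fixes a b c d x y :: "'a::field"
  assumes det: "a * d - b * c \<noteq> 0" and "(x, y) \<noteq> (0, 0)"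
  shows "(a * x + b * y, c * x + d * y) \<noteq> (0, 0)"
proof
  assume "(a * x + b * y, c * x + d * y) = (0, 0)"
  then have z: "a * x + b * y = 0" "c * x + d * y = 0" by simp_all
  have "(a * d - b * c) * x = d * (a * x + b * y) - b * (c * x + d * y)"
    "(a * d - b * c) * y = a * (c * x + d * y) - c * (a * x + b * y)"
    by (simp_all add: algebra_simps)
  then show False using z det assms(2) by simp
qed

lemma act_proj_line:
  assumes "f \<in> GL2" "S \<subseteq> proj_line"
  shows "act f S \<subseteq> proj_line"
proof
  fix P assume "P \<in> act f S"
  then obtain x y where xy: "P = f ` proj_point x y" "(x, y) \<noteq> (0, 0)"
    using assms(2) unfolding act_def proj_line_def by blast
  obtain a b c d where f: "f = lin_map a b c d" and det: "a * d - b * c \<noteq> 0"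
    using assms(1) unfolding GL2_def by blast
  show "P \<in> proj_line"
    using lin_map_nonzero[OF det xy(2)]
    unfolding xy f lin_map_image_proj_point proj_line_def by blast
qed

text \<open>Projective equivalence becomes membership in an orbit of \<open>GL2\<close>, the form in
  which orbits are counted; \<open>act_proj_line\<close> supplies the inclusion of the
  image.\<close>

lemma proj_equivalent_iff:
  "proj_equivalent S T \<longleftrightarrow> S \<subseteq> proj_line \<and> (\<exists>f\<in>GL2. T = act f S)"
proof -
  have "(\<exists>f\<in>GL2. T = act f S) \<longleftrightarrow> (\<exists>m11 m12 m21 m22. m11 * m22 - m12 * m21 \<noteq> 0 \<and>
      T = act (lin_map m11 m12 m21 m22) S)" (is "_ \<longleftrightarrow> ?R")
  proof
    assume ?R
    then obtain a b c d where "a * d - b * c \<noteq> 0" "T = act (lin_map a b c d) S" by blast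
    then show "\<exists>f\<in>GL2. T = act f S" by (intro bexI[of _ "lin_map a b c d"]) (auto simp: GL2_def)
  qed (auto simp: GL2_def)
  moreover have "T \<subseteq> proj_line" if "S \<subseteq> proj_line" "\<exists>f\<in>GL2. T = act f S"
    using that act_proj_line by auto
  ultimately show ?thesis unfolding proj_equivalent_def act_def by metis
qed

text \<open>Orbit--stabilizer: each orbit element is hit by one coset of the stabilizer of \<open>B\<close>, and
  since \<open>B\<close> is finite, \<open>act f B \<subseteq> B\<close> already forces equality.\<close>

lemma card_orbit_in_translate:
  fixes B L0 :: "('a::{field, finite} \<times> 'a) set set"
  assumes g: "g \<in> GL2"
  shows "card {S. (\<exists>f\<in>GL2. S = act f B) \<and> S \<subseteq> act g L0} * card {f \<in> GL2. act f B \<subseteq> B} =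
    card {f \<in> GL2. act f B \<subseteq> L0}"
proof -
  let ?A = "{f \<in> GL2. act f B \<subseteq> act g L0}" and ?Stab = "{f \<in> GL2. act f B \<subseteq> B}"
  let ?T = "{S. (\<exists>f\<in>GL2. S = act f B) \<and> S \<subseteq> act g L0}"
  have inj: "inj ((\<circ>) f)" if "f \<in> GL2" for f :: "'a \<times> 'a \<Rightarrow> 'a \<times> 'a"
  proof -
    obtain h where "h \<circ> f = id" using GL2_inverse[OF \<open>f \<in> GL2\<close>] by blast
    then show ?thesis by (intro injI) (metis comp_assoc id_comp)
  qed
  obtain g' where g': "g' \<in> GL2" "g \<circ> g' = id" "g' \<circ> g = id" using GL2_inverse[OF g] by blast
  \<comment> \<open>Left translation by \<open>g\<close> matches the maps into \<open>L0\<close>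
    with the maps into \<open>act g L0\<close>, which reduces the count to the standard set
    \<open>L0\<close>.\<close>
  have "?A = (\<circ>) g ` {f \<in> GL2. act f B \<subseteq> L0}"
  proof (intro equalityI subsetI)
    fix f assume f: "f \<in> ?A"
    then have "act (g' \<circ> f) B \<subseteq> act g' (act g L0)"
      unfolding act_comp by (intro act_mono) simp
    also have "\<dots> = L0" using g' by (simp flip: act_comp add: act_id)
    finally have "g' \<circ> f \<in> {f \<in> GL2. act f B \<subseteq> L0}" using f g' GL2_comp by blast
    moreover have "f = g \<circ> (g' \<circ> f)" using g' by (simp flip: comp_assoc)
    ultimately show "f \<in> (\<circ>) g ` {f \<in> GL2. act f B \<subseteq> L0}" by blast
  next
    fix f assume "f \<in> (\<circ>) g ` {f \<in> GL2. act f B \<subseteq> L0}"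
    then obtain h where h: "f = g \<circ> h" "h \<in> GL2" "act h B \<subseteq> L0" by blast
    then show "f \<in> ?A" using GL2_comp[OF g h(2)] act_mono[OF h(3)] by (simp add: act_comp)
  qed
  then have A: "card ?A = card {f \<in> GL2. act f B \<subseteq> L0}"
    by (simp add: card_image[OF inj_on_subset[OF inj[OF g] subset_UNIV]])
  have fib: "card {f \<in> ?A. act f B = S} = card ?Stab" if S: "S \<in> ?T" for S
  proof -
    obtain f0 where f0: "f0 \<in> GL2" "S = act f0 B" "S \<subseteq> act g L0" using S by blast
    obtain f' where f': "f' \<in> GL2" "f0 \<circ> f' = id" "f' \<circ> f0 = id" using GL2_inverse[OF f0(1)] by blast
    have "{f \<in> ?A. act f B = S} = (\<circ>) f0 ` ?Stab"
    proof (intro equalityI subsetI)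
      fix f assume f: "f \<in> {f \<in> ?A. act f B = S}"
      then have "act (f' \<circ> f) B = act (f' \<circ> f0) B" unfolding act_comp using f0 by simp
      then have "f' \<circ> f \<in> ?Stab" using f f' GL2_comp by (auto simp: act_id)
      moreover have "f = f0 \<circ> (f' \<circ> f)" using f' by (simp flip: comp_assoc)
      ultimately show "f \<in> (\<circ>) f0 ` ?Stab" by blast
    next
      fix f assume "f \<in> (\<circ>) f0 ` ?Stab"
      then obtain h where h: "f = f0 \<circ> h" "h \<in> GL2" "act h B \<subseteq> B" by blast
      have "card (act h B) = card B"
        unfolding act_def using inj_act_point[OF h(2)] by (intro card_image) (rule inj_on_subset, auto)
      then have "act h B = B" using h(3) by (intro card_subset_eq) auto
      then show "f \<in> {f \<in> ?A. act f B = S}" using h f0 GL2_comp by (auto simp: act_comp)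
    qed
    then show ?thesis by (simp add: card_image[OF inj_on_subset[OF inj[OF f0(1)] subset_UNIV]])
  qed
  have "card ?A = (\<Sum>S\<in>(\<lambda>f. act f B) ` ?A. card {f \<in> ?A. act f B = S})"
    using sum.image_gen[of ?A "\<lambda>_. 1::nat" "\<lambda>f. act f B"] by simp
  also have "(\<lambda>f. act f B) ` ?A = ?T" by blast
  also have "(\<Sum>S\<in>?T. card {f \<in> ?A. act f B = S}) = (\<Sum>S\<in>?T. card ?Stab)"
    by (rule sum.cong[OF refl fib])
  finally show ?thesis using A by simp
qed

section \<open>Finite field extensions\<close>

text \<open>A bridge from the ring record to the class operations. Negatives and inverses are
  derived notions of the record, so they are identified by uniqueness.\<close>

lemma subfield_closedD:
  fixes K :: "'a::field set"
  assumes "subfield K (ring_of_type_algebra :: 'a ring)"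
  shows "0 \<in> K" "1 \<in> K"
    "\<And>x y. x \<in> K \<Longrightarrow> y \<in> K \<Longrightarrow> x + y \<in> K"
    "\<And>x y. x \<in> K \<Longrightarrow> y \<in> K \<Longrightarrow> x * y \<in> K"
    "\<And>x. x \<in> K \<Longrightarrow> - x \<in> K"
    "\<And>x y. x \<in> K \<Longrightarrow> y \<in> K \<Longrightarrow> x - y \<in> K"
    "\<And>x y. x \<in> K \<Longrightarrow> y \<in> K \<Longrightarrow> x / y \<in> K"
proof -
  let ?R = "ring_of_type_algebra :: 'a ring"
  interpret R: Ring.field ?R by (rule field_from_type_algebra)
  have sr: "subring K ?R" using assms by (rule subfieldE)
  show z: "0 \<in> K" using subringE(2)[OF sr] by (simp add: ring_of_type_algebra_def)
  show "1 \<in> K" using subringE(3)[OF sr] by (simp add: ring_of_type_algebra_def)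
  show a: "x + y \<in> K" if "x \<in> K" "y \<in> K" for x y
    using subringE(7)[OF sr that] by (simp add: ring_of_type_algebra_def)
  show m: "x * y \<in> K" if "x \<in> K" "y \<in> K" for x y
    using subringE(6)[OF sr that] by (simp add: ring_of_type_algebra_def)
  show n: "- x \<in> K" if "x \<in> K" for x
  proof -
    have "\<ominus>\<^bsub>?R\<^esub> x = - x"
      by (rule R.minus_equality) (auto simp: ring_of_type_algebra_def)
    then show ?thesis using subringE(5)[OF sr that] by simp
  qed
  show "x - y \<in> K" if "x \<in> K" "y \<in> K" for x y
    using a[OF that(1) n[OF that(2)]] by simp
  \<comment> \<open>The convention \<open>inverse 0 = 0\<close> makes \<open>K\<close> closed under
    all quotients, including \<open>x / 0\<close>; the slopes \<open>v / u\<close> of points rely on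
    this later.\<close>
  have i: "inverse x \<in> K" if "x \<in> K" for x
  proof (cases "x = 0")
    case False
    have "inv\<^bsub>?R\<^esub> x = inverse x"
      by (rule R.inv_unique'[symmetric]) (use False in \<open>auto simp: ring_of_type_algebra_def\<close>)
    moreover have "inv\<^bsub>?R\<^esub> x \<in> K - {\<zero>\<^bsub>?R\<^esub>}"
      by (rule R.subfield_m_inv(1)[OF assms]) (use that False in \<open>auto simp: ring_of_type_algebra_def\<close>)
    ultimately show ?thesis by simp
  qed (use z in simp)
  show "x / y \<in> K" if "x \<in> K" "y \<in> K" for x y
    using m[OF that(1) i[OF that(2)]] by (simp add: field_class.field_divide_inverse)
qed

text \<open>The converse bridge, meant for the fixed field of a Frobenius power in
  \<open>card_conjugates\<close>.\<close>

lemma subfield_typeI: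
  fixes E :: "'a::field set"
  assumes "1 \<in> E"
    and add: "\<And>x y. x \<in> E \<Longrightarrow> y \<in> E \<Longrightarrow> x + y \<in> E"
    and uminus: "\<And>x. x \<in> E \<Longrightarrow> - x \<in> E"
    and mult: "\<And>x y. x \<in> E \<Longrightarrow> y \<in> E \<Longrightarrow> x * y \<in> E"
    and inverse: "\<And>x. x \<in> E \<Longrightarrow> inverse x \<in> E"
  shows "subfield E (ring_of_type_algebra :: 'a ring)"
proof -
  let ?R = "ring_of_type_algebra :: 'a ring"
  interpret R: Ring.field ?R by (rule field_from_type_algebra)
  have neg: "\<ominus>\<^bsub>?R\<^esub> x = - x" for x
    by (rule R.minus_equality) (auto simp: ring_of_type_algebra_def)
  have inv: "inv\<^bsub>?R\<^esub> x = inverse x" if "x \<noteq> 0" for x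
    by (rule R.inv_unique'[symmetric]) (use that in \<open>auto simp: ring_of_type_algebra_def\<close>)
  show ?thesis
  proof (rule R.subfieldI')
    show "subring E ?R"
      by (rule R.subringI)
        (use neg uminus assms(1) add mult in \<open>auto simp: ring_of_type_algebra_def\<close>)
    show "inv\<^bsub>?R\<^esub> k \<in> E" if "k \<in> E - {\<zero>\<^bsub>?R\<^esub>}" for k
    proof -
      have "k \<noteq> 0" using that by (simp add: ring_of_type_algebra_def)
      then show ?thesis using inv inverse that by auto
    qed
  qed
qed

text \<open>Fermat's argument: multiplication by a nonzero \<open>x\<close> permutes the nonzero
  elements of \<open>S\<close>, so comparing their product before and after gives
  \<open>x ^ (card S - 1) = 1\<close>. It is applied to \<open>K\<close>, to \<open>K(y)\<close> and
  to the whole field.\<close>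

lemma power_card_eq_self:
  fixes S :: "'a::field set"
  assumes "finite S" "0 \<in> S" and mult: "\<And>x y. x \<in> S \<Longrightarrow> y \<in> S \<Longrightarrow> x * y \<in> S"
    and "x \<in> S"
  shows "x ^ card S = x"
proof (cases "x = 0")
  case True
  have "card S > 0" using assms(1,2) by (auto simp: card_gt_0_iff)
  then show ?thesis using True by simp
next
  case False
  let ?T = "S - {0}"
  have "inj_on ((*) x) ?T" using False by (auto intro: inj_onI)
  moreover have "(*) x ` ?T \<subseteq> ?T" using False mult assms(4) by auto
  ultimately have bij: "bij_betw ((*) x) ?T ?T"
    using assms(1) by (simp add: bij_betw_def endo_inj_surj)
  have "(\<Prod>s\<in>?T. s) = (\<Prod>s\<in>?T. x * s)"
    using prod.reindex_bij_betw[OF bij, of "\<lambda>s. s"] by simp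
  also have "\<dots> = x ^ card ?T * (\<Prod>s\<in>?T. s)" by (simp add: prod.distrib)
  finally have "1 * (\<Prod>s\<in>?T. s) = x ^ card ?T * (\<Prod>s\<in>?T. s)" unfolding mult_1_left .
  moreover have "(\<Prod>s\<in>?T. s) \<noteq> 0" using assms(1) by simp
  ultimately have "x ^ card ?T = 1" by (metis mult_right_cancel)
  moreover have "card S = Suc (card ?T)" using card.remove[OF assms(1,2)] .
  ultimately show ?thesis by simp
qed

text \<open>Each step of the inductive dimension adds a direct summand \<open>K v\<close>, which
  multiplies the cardinality by \<open>card K\<close>.\<close>

lemma dimension_card:
  fixes K :: "'a::{field, finite} set"
  assumes sub: "subfield K (ring_of_type_algebra :: 'a ring)"
    and dim: "ring.dimension (ring_of_type_algebra :: 'a ring) n K E"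
  shows "card E = card K ^ n"
proof -
  let ?R = "ring_of_type_algebra :: 'a ring"
  interpret R: Ring.field ?R by (rule field_from_type_algebra)
  \<comment> \<open>The claim is strengthened by closure under addition and scalars, which the
    injectivity of \<open>?f\<close> requires.\<close>
  have "0 \<in> E \<and> (\<forall>x\<in>E. \<forall>y\<in>E. x + y \<in> E) \<and> (\<forall>k\<in>K. \<forall>x\<in>E. k * x \<in> E) \<and> card E = card K ^ n"
    using dim sub
  proof (induction rule: R.dimension.induct)
    case (zero_dim K)
    then show ?case by (simp add: ring_of_type_algebra_def)
  next
    case (Suc_dim v E n K)
    note K = subfield_closedD[OF Suc_dim.prems]
    have E: "0 \<in> E" "\<And>x y. x \<in> E \<Longrightarrow> y \<in> E \<Longrightarrow> x + y \<in> E"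
      "\<And>k x. k \<in> K \<Longrightarrow> x \<in> E \<Longrightarrow> k * x \<in> E" "card E = card K ^ n"
      using Suc_dim.IH[OF Suc_dim.prems] by auto
    have E_diff: "x - y \<in> E" if "x \<in> E" "y \<in> E" for x y
      using E(2)[OF that(1) E(3)[OF K(5)[OF K(2)] that(2)]] by simp
    let ?f = "\<lambda>(k, e). k * v + e"
    have ext: "R.line_extension K v E = ?f ` (K \<times> E)"
      unfolding R.line_extension_def set_add_def' r_coset_def
      by (auto simp: ring_of_type_algebra_def image_iff)
    have "inj_on ?f (K \<times> E)"
    proof (rule inj_onI, clarify)
      fix k e k' e'
      assume *: "k \<in> K" "e \<in> E" "k' \<in> K" "e' \<in> E" "k * v + e = k' * v + e'"
      \<comment> \<open>Two representations with different scalars could be solved for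
        \<open>v\<close>, placing it in \<open>E\<close>.\<close>
      have "k = k'"
      proof (rule ccontr)
        assume "k \<noteq> k'"
        moreover have "(k - k') * v = e' - e" using *(5) by (simp add: algebra_simps)
        ultimately have "v = (1 / (k - k')) * (e' - e)" by (simp add: field_simps)
        also have "\<dots> \<in> E" using * by (intro E(3) K E_diff) auto
        finally show False using Suc_dim.hyps(2) by simp
      qed
      then show "k = k' \<and> e = e'" using *(5) by simp
    qed
    then have "card (R.line_extension K v E) = card K ^ Suc n"
      unfolding ext by (simp add: card_image card_cartesian_product E(4))
    moreover have "0 \<in> R.line_extension K v E"
      unfolding ext using K(1) E(1) by (auto intro!: image_eqI[of _ _ "(0, 0)"])
    moreover have "x + y \<in> R.line_extension K v E"
      if xy: "x \<in> R.line_extension K v E" "y \<in> R.line_extension K v E" for x y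
    proof -
      obtain k e k' e' where "k \<in> K" "e \<in> E" "k' \<in> K" "e' \<in> E"
        and "x = k * v + e" "y = k' * v + e'"
        using xy unfolding ext by auto
      then show ?thesis unfolding ext
        by (intro image_eqI[of _ _ "(k + k', e + e')"]) (auto simp: algebra_simps K E)
    qed
    moreover have "c * x \<in> R.line_extension K v E"
      if c: "c \<in> K" and x: "x \<in> R.line_extension K v E" for c x
    proof -
      obtain k e where "k \<in> K" "e \<in> E" "x = k * v + e" using x unfolding ext by auto
      then show ?thesis unfolding ext using c
        by (intro image_eqI[of _ _ "(c * k, c * e)"]) (auto simp: algebra_simps K E)
    qed
    ultimately show ?case by blast
  qed
  then show ?thesis by simp
qed

text \<open>The description in \<open>adjoin_degree\<close> denotes: \<open>K(y)\<close> is finite,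
  hence spanned over \<open>K\<close> by a list of all its elements, and its dimension is
  unique.\<close>

lemma adjoin_degree_card:
  fixes K :: "'a::{field, finite} set"
  assumes sub: "subfield K (ring_of_type_algebra :: 'a ring)"
  shows "card (generate_field (ring_of_type_algebra :: 'a ring) (insert y K)) = card K ^ adjoin_degree K y"
proof -
  let ?R = "ring_of_type_algebra :: 'a ring"
  let ?E = "generate_field ?R (insert y K)"
  interpret R: Ring.field ?R by (rule field_from_type_algebra)
  have carr: "carrier ?R = UNIV" by (simp add: ring_of_type_algebra_def)
  have E: "subfield ?E ?R" by (rule R.generate_field_is_subfield) (simp add: carr)
  have "K \<subseteq> ?E" by (auto intro: generate_field.incl)
  then have sp: "subalgebra K ?E ?R"
    using R.generate_field_is_add_subgroup[of "insert y K"] generate_field.eng_mult[of _ ?R]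
    by (auto simp: subalgebra_def subalgebra_axioms_def carr)
  obtain us where us: "set us = ?E" using finite_list[of ?E] by auto
  have "?E = R.Span K us"
    by (rule R.Span_subalgebraI[OF sub sp]) (simp_all add: us)
  then have "R.finite_dimension K ?E"
    using R.Span_finite_dimension[OF sub, of us] carr by simp
  then obtain n where n: "R.dimension n K ?E" by (auto simp: R.finite_dimension_def)
  have "adjoin_degree K y = n"
    unfolding adjoin_degree_def using R.dimension_is_inj[OF sub _ n] n by (intro the_equality)
  then show ?thesis using dimension_card[OF sub n] by simp
qed

lemma sum_powers_mult:
  "(\<Sum>i<t. q ^ i) * (q - 1) = q ^ t - (1 :: nat)" if "q \<ge> 1"
proof (induction t)
  case (Suc t)
  have "q ^ t \<ge> 1" using that by simp
  moreover have "q ^ Suc t = q ^ t + q ^ t * (q - 1)"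
    using that by (cases q) auto
  ultimately show ?case using Suc by (simp add: distrib_right)
qed simp

section \<open>Frobenius powers and conjugates\<close>

locale finite_field_extension =
  fixes K :: "'a::{field, finite} set" and q t :: nat
  assumes card_UNIV: "CARD('a) = q ^ t"
    and subfield: "subfield K (ring_of_type_algebra :: 'a ring)"
    and card_K: "card K = q"
begin

lemmas K_closed = subfield_closedD[OF subfield]

lemma q_ge_2: "q \<ge> 2"
proof -
  have "card {0::'a, 1} \<le> card K" by (rule card_mono) (simp_all add: K_closed)
  then show ?thesis using card_K by simp
qed

lemma t_pos: "t > 0"
proof (rule ccontr)
  assume "\<not> t > 0"
  then have "CARD('a) = 1" using card_UNIV by simp
  moreover have "card {0::'a, 1} \<le> CARD('a)" by (rule card_mono) auto
  ultimately show False by simp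
qed

lemma power_q_K: "x ^ q = x" if "x \<in> K"
  using power_card_eq_self[OF _ K_closed(1) K_closed(4) that] card_K by simp

lemma power_q_t: "(x::'a) ^ (q ^ t) = x"
  using power_card_eq_self[of UNIV x] card_UNIV by simp

text \<open>\<open>(X + 1)\<^sup>q - X\<^sup>q - 1\<close> has degree less than \<open>q\<close> and vanishes on all \<open>q\<close> elements of \<open>K\<close>.\<close>

lemma frobenius_add_1: "((x::'a) + 1) ^ q = x ^ q + 1"
proof -
  define P where "P = [:1, 1:] ^ q - monom 1 q - (1 :: 'a poly)"
  have lc: "lead_coeff ([:1, 1:] ^ q :: 'a poly) = 1" by (simp add: lead_coeff_power)
  have dp: "degree ([:1, 1:] ^ q :: 'a poly) = q" by (simp add: degree_power_eq)
  have "P = 0"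
  proof (rule ccontr)
    assume "P \<noteq> 0"
    have "coeff P q = 0"
      using lc dp q_ge_2 by (simp add: P_def)
    moreover have "degree P \<le> q"
      unfolding P_def by (intro degree_diff_le) (simp_all add: dp degree_monom_le)
    ultimately have "degree P < q"
      using \<open>P \<noteq> 0\<close> by (metis le_neq_implies_less leading_coeff_0_iff)
    moreover have "K \<subseteq> {x. poly P x = 0}"
    proof
      fix x assume "x \<in> K"
      then have "(x + 1) ^ q = x + 1" "x ^ q = x" by (intro power_q_K K_closed; assumption)+
      then show "x \<in> {x. poly P x = 0}" by (simp add: P_def poly_monom add.commute)
    qed
    then have "card K \<le> card {x. poly P x = 0}"
      by (rule card_mono[OF poly_roots_finite[OF \<open>P \<noteq> 0\<close>]])
    then have "q \<le> degree P"
      using card_poly_roots_bound[OF \<open>P \<noteq> 0\<close>] card_K by simp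
    ultimately show False by simp
  qed
  then have "poly P x = 0" by simp
  then have "(1 + x) ^ q - x ^ q - 1 = 0" by (simp add: P_def poly_monom)
  then show ?thesis by (simp add: add.commute diff_eq_eq)
qed

text \<open>Dividing by a nonzero \<open>y\<close> reduces the claim to
  \<open>frobenius_add_1\<close>.\<close>

lemma frobenius_add: "((x::'a) + y) ^ q = x ^ q + y ^ q"
proof (cases "y = 0")
  case True
  then show ?thesis using q_ge_2 by simp
next
  case False
  then have "x + y = y * (x / y + 1)" by (simp add: field_simps)
  then have "(x + y) ^ q = (y * (x / y + 1)) ^ q" by simp
  also have "\<dots> = y ^ q * ((x / y) ^ q + 1)" by (simp add: power_mult_distrib frobenius_add_1)
  also have "\<dots> = x ^ q + y ^ q" using False by (simp add: field_simps)
  finally show ?thesis .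
qed

lemma frobenius_pow_Suc: "(x::'a) ^ (q ^ Suc i) = (x ^ (q ^ i)) ^ q"
  unfolding power_mult[symmetric] by (simp add: mult.commute)

lemma frobenius_pow_add: "((x::'a) + y) ^ (q ^ i) = x ^ (q ^ i) + y ^ (q ^ i)"
  by (induction i) (simp_all only: frobenius_pow_Suc frobenius_add power_0 power_one_right)

lemma frobenius_pow_diff: "((x::'a) - y) ^ (q ^ i) = x ^ (q ^ i) - y ^ (q ^ i)"
  using frobenius_pow_add[of "x - y" y i] by (simp add: algebra_simps)

lemma frobenius_pow_minus: "(- (x::'a)) ^ (q ^ i) = - (x ^ (q ^ i))"
  using frobenius_pow_diff[of 0 x i] q_ge_2 by simp

lemma frobenius_pow_inj: "(x::'a) ^ (q ^ i) = y ^ (q ^ i) \<longleftrightarrow> x = y"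
  using frobenius_pow_diff[of x y i] by (auto simp: q_ge_2)

lemma frobenius_pow_K: "x ^ (q ^ i) = x" if "x \<in> K"
  using that by (induction i) (simp_all only: frobenius_pow_Suc power_q_K power_0 power_one_right)

text \<open>The fixed points are the roots of X^(q^d) - X. As \<open>d > 0\<close> gives
  \<open>q ^ d > 1\<close>, its two monomials do not cancel and the root bound applies.\<close>

lemma frobenius_fixed_roots:
  assumes "d > 0"
  shows "card {x::'a. x ^ (q ^ d) = x} \<le> q ^ d"
proof -
  define P where "P = monom 1 (q ^ d) - [:0, 1 :: 'a:]"
  have "q ^ d > 1" using assms q_ge_2 by (intro one_less_power) simp_all
  have deg1: "degree [:0, 1 :: 'a:] = 1" by simp
  with \<open>q ^ d > 1\<close> have "coeff [:0, 1 :: 'a:] (q ^ d) = 0" by (intro coeff_eq_0) simp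
  then have "coeff P (q ^ d) = 1" unfolding P_def by simp
  then have "P \<noteq> 0" by force
  then have "card {x. poly P x = 0} \<le> degree P" by (rule card_poly_roots_bound)
  also have "\<dots> \<le> q ^ d"
    unfolding P_def using \<open>q ^ d > 1\<close> deg1 by (intro degree_diff_le degree_monom_le) simp
  finally show ?thesis unfolding P_def by (simp add: poly_monom)
qed

text \<open>The \<open>q\<close> elements of \<open>K\<close> are fixed, and there are at most
  \<open>q\<close> fixed points.\<close>

lemma K_eq_fixed: "K = {x. x ^ q = x}"
proof (rule card_subset_eq)
  show "K \<subseteq> {x. x ^ q = x}" using power_q_K by auto
  then have "card K \<le> card {x::'a. x ^ q = x}" by (intro card_mono) auto
  then show "card K = card {x::'a. x ^ q = x}"
    using frobenius_fixed_roots[of 1] card_K by simp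
qed simp

text \<open>The Galois orbit of \<open>y\<close> over \<open>K\<close>. Letting \<open>i\<close> run
  over all naturals avoids fixing a period in advance.\<close>

definition conjugates :: "'a \<Rightarrow> 'a set" where
  "conjugates y = range (\<lambda>i. y ^ (q ^ i))"

lemma self_in_conjugates: "y \<in> conjugates y"
  unfolding conjugates_def by (rule image_eqI[of _ _ 0]) auto

lemma conjugates_K: "conjugates y = {y}" if "y \<in> K"
  using that by (auto simp: conjugates_def frobenius_pow_K)

lemma frobenius_period:
  assumes "(y::'a) ^ (q ^ n) = y"
  shows "y ^ (q ^ i) = y ^ (q ^ (i mod n))"
proof -
  have "y ^ (q ^ (n * k + j)) = y ^ (q ^ j)" for k j
  proof (induction k)
    case (Suc k)
    have "y ^ (q ^ (n * Suc k + j)) = (y ^ (q ^ n)) ^ (q ^ (n * k + j))"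
      by (simp add: power_add algebra_simps flip: power_mult)
    then show ?case using Suc assms by simp
  qed simp
  from this[of "i div n" "i mod n"] show ?thesis by simp
qed

text \<open>With \<open>n\<close> the degree, \<open>K(y)\<close> has \<open>q ^ n\<close> elements,
  so \<open>y\<close> has period \<open>n\<close> under Frobenius and its conjugates are the first
  \<open>n\<close> powers. It remains to see that these are distinct.\<close>

lemma card_conjugates: "card (conjugates y) = adjoin_degree K y"
proof -
  let ?R = "ring_of_type_algebra :: 'a ring"
  interpret R: Ring.field ?R by (rule field_from_type_algebra)
  define n where "n = adjoin_degree K y"
  let ?E = "generate_field ?R (insert y K)"
  have carr: "carrier ?R = UNIV" by (simp add: ring_of_type_algebra_def)
  have sub: "subfield ?E ?R" by (rule R.generate_field_is_subfield) (simp add: carr)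
  note E = subfield_closedD[OF sub]
  have card_E: "card ?E = q ^ n"
    using adjoin_degree_card[OF subfield] card_K n_def by simp
  have yE: "y \<in> ?E" by (auto intro: generate_field.incl)
  have "card {0::'a, 1} \<le> card ?E" by (rule card_mono) (simp_all add: E)
  then have "n > 0" using card_E by (cases n) auto
  have per: "y ^ (q ^ n) = y"
    using power_card_eq_self[OF _ E(1) E(4) yE] card_E by simp
  have 1: "conjugates y = (\<lambda>i. y ^ (q ^ i)) ` {..<n}"
  proof
    show "conjugates y \<subseteq> (\<lambda>i. y ^ (q ^ i)) ` {..<n}"
      unfolding conjugates_def
    proof (rule image_subsetI)
      show "y ^ (q ^ i) \<in> (\<lambda>i. y ^ (q ^ i)) ` {..<n}" for i
        using frobenius_period[OF per] \<open>n > 0\<close> by (intro image_eqI[of _ _ "i mod n"]) simp_all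
    qed
  qed (auto simp: conjugates_def)
  have "y ^ (q ^ i) \<noteq> y ^ (q ^ j)" if "i < j" "j < n" for i j
  proof
    assume eq: "y ^ (q ^ i) = y ^ (q ^ j)"
    define d where "d = j - i"
    have d: "0 < d" "d < n" "j = d + i" using that by (auto simp: d_def)
    \<comment> \<open>Cancelling the injective power \<open>q ^ i\<close> leaves a period
      \<open>d < n\<close>. The elements fixed by this power form a field containing
      \<open>K\<close> and \<open>y\<close>, hence \<open>?E\<close>, yet number at most
      \<open>q ^ d\<close>.\<close>
    have "(y ^ (q ^ d)) ^ (q ^ i) = y ^ (q ^ i)"
      using eq d(3) by (simp add: power_add power_mult)
    then have yd: "y ^ (q ^ d) = y" by (simp add: frobenius_pow_inj)
    let ?F = "{x::'a. x ^ (q ^ d) = x}"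
    have "subfield ?F ?R"
    proof (rule subfield_typeI)
      show "inverse x \<in> ?F" if "x \<in> ?F" for x
        using that by (simp only: mem_Collect_eq power_inverse)
    qed (auto simp: frobenius_pow_add frobenius_pow_minus power_mult_distrib)
    moreover have "insert y K \<subseteq> ?F" using yd by (auto simp: frobenius_pow_K)
    ultimately have "?E \<subseteq> ?F" by (intro R.generate_field_min_subfield1) (simp_all add: carr)
    then have "q ^ n \<le> card ?F" using card_E by (metis card_mono finite_code)
    also have "\<dots> \<le> q ^ d" by (rule frobenius_fixed_roots[OF d(1)])
    also have "\<dots> < q ^ n" using d(2) q_ge_2 by simp
    finally show False by simp
  qed
  then have "inj_on (\<lambda>i. y ^ (q ^ i)) {..<n}"
    by (intro linorder_inj_onI) auto
  then show ?thesis using 1 by (simp add: card_image n_def)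
qed

section \<open>The norm\<close>

definition Norm :: "'a \<Rightarrow> 'a" where
  "Norm x = (\<Prod>i<t. x ^ (q ^ i))"

lemma Norm_mult: "Norm (x * y) = Norm x * Norm y"
  by (simp add: Norm_def power_mult_distrib prod.distrib)

lemma Norm_divide: "Norm (x / y) = Norm x / Norm y"
  by (simp add: Norm_def power_divide prod_dividef)

lemma Norm_eq_0_iff: "Norm x = 0 \<longleftrightarrow> x = 0"
  using t_pos q_ge_2 by (auto simp: Norm_def)

lemma Norm_power: "Norm (x ^ n) = Norm x ^ n"
  by (simp add: Norm_def prod_power_distrib mult.commute flip: power_mult)

lemma Norm_eq_power: "Norm x = x ^ (\<Sum>i<t. q ^ i)"
  by (simp add: Norm_def power_sum)

text \<open>Frobenius shifts the factors cyclically: the new last factor \<open>x ^ (q ^ t)\<close>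
  is the old first factor \<open>x\<close>.\<close>

lemma Norm_power_q: "Norm (x ^ q) = Norm x"
proof (cases "x = 0")
  case True
  then show ?thesis using q_ge_2 by (simp add: zero_power)
next
  case False
  have "Norm (x ^ q) = (\<Prod>i<t. x ^ (q ^ Suc i))"
    by (simp add: Norm_def flip: power_mult)
  moreover have "x * (\<Prod>i<t. x ^ (q ^ Suc i)) = (\<Prod>i<Suc t. x ^ (q ^ i))"
    by (subst prod.lessThan_Suc_shift) simp
  moreover have "\<dots> = Norm x * x"
    unfolding Norm_def prod.lessThan_Suc power_q_t ..
  ultimately have "x * Norm (x ^ q) = x * Norm x" by (simp only: mult.commute)
  then show ?thesis using False by simp
qed

lemma Norm_in_K: "Norm x \<in> K"
  using Norm_power_q[of x] by (simp add: K_eq_fixed Norm_power)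

lemma Norm_power_q_pow: "Norm (x ^ (q ^ i)) = Norm x"
  by (simp only: Norm_power frobenius_pow_K[OF Norm_in_K])

lemma Norm_power_q_minus_1:
  assumes "x \<noteq> 0" shows "Norm (x ^ (q - 1)) = 1"
proof -
  have "Norm x * Norm x ^ (q - 1) = Norm x ^ q"
    using q_ge_2 by (simp add: power_eq_if)
  then show ?thesis
    using assms power_q_K[OF Norm_in_K, of x] by (simp add: Norm_power Norm_eq_0_iff)
qed

lemma theta_nat_pos: "(\<Sum>i<t. q ^ i) > 0"
proof -
  have "q ^ 0 \<le> (\<Sum>i<t. q ^ i)"
    using t_pos by (intro member_le_sum) auto
  then show ?thesis by simp
qed

text \<open>Counting replaces Hilbert 90: the fibres of \<open>x \<mapsto> x\<^sup>q\<^sup>-\<^sup>1\<close> on the nonzero elements have at most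
  \<open>q - 1\<close> elements, while \<open>Norm z = 1\<close> is a polynomial equation with few roots.\<close>

lemma
  shows Norm_1_eq_powers: "{z. Norm z = 1} = (\<lambda>x. x ^ (q - 1)) ` (UNIV - {0})"
    and card_Norm_1: "card {z. Norm z = 1} = (\<Sum>i<t. q ^ i)"
proof -
  let ?m = "\<Sum>i<t. q ^ i" and ?N = "{z. Norm z = 1}" and ?f = "\<lambda>x::'a. x ^ (q - 1)"
  let ?I = "?f ` (UNIV - {0})"
  have sub: "?I \<subseteq> ?N" using Norm_power_q_minus_1 by auto
  define P where "P = monom 1 ?m - (1 :: 'a poly)"
  have "coeff (1 :: 'a poly) ?m = 0" using theta_nat_pos by (intro coeff_eq_0) simp
  then have "coeff P ?m = 1" unfolding P_def by simp
  then have "P \<noteq> 0" by force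
  then have "card {x. poly P x = 0} \<le> degree P" by (rule card_poly_roots_bound)
  also have "\<dots> \<le> ?m"
    unfolding P_def by (intro degree_diff_le degree_monom_le) simp
  finally have le: "card ?N \<le> ?m" by (simp add: P_def poly_monom Norm_eq_power)
  have fib: "card {x \<in> UNIV - {0}. ?f x = z} \<le> q - 1" for z
  proof (cases "\<exists>x0. x0 \<noteq> 0 \<and> ?f x0 = z")
    case True
    then obtain x0 where x0: "x0 \<noteq> 0" "?f x0 = z" by blast
    \<comment> \<open>Two elements of one fibre have a ratio \<open>r\<close> with
      \<open>r ^ (q - 1) = 1\<close>, so \<open>r ^ q = r\<close> and \<open>r\<close> lies in
      \<open>K\<close>.\<close>
    have "{x \<in> UNIV - {0}. ?f x = z} \<subseteq> (\<lambda>k. k * x0) ` (K - {0})"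
    proof
      fix x assume x: "x \<in> {x \<in> UNIV - {0}. ?f x = z}"
      then have "(x / x0) ^ (q - 1) = 1" using x0 by (auto simp: power_divide)
      then have "(x / x0) ^ q = x / x0" using q_ge_2 by (simp add: power_eq_if[of _ q])
      then have "x / x0 \<in> K" unfolding K_eq_fixed by simp
      then show "x \<in> (\<lambda>k. k * x0) ` (K - {0})"
        using x x0 by (intro image_eqI[of _ _ "x / x0"]) auto
    qed
    then have "card {x \<in> UNIV - {0}. ?f x = z} \<le> card (K - {0})"
      by (rule surj_card_le[rotated]) simp
    then show ?thesis using K_closed(1) card_K by simp
  next
    case False
    then have "{x \<in> UNIV - {0}. ?f x = z} = {}" by auto
    then show ?thesis by (simp only: card.empty)
  qed
  \<comment> \<open>Summing over the fibres bounds \<open>card ?I\<close> below by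
    \<open>?m\<close>, while the root count bounds \<open>card ?N\<close> above by
    \<open>?m\<close>; the inclusion of \<open>?I\<close> in \<open>?N\<close> is squeezed to
    equality.\<close>
  have "q ^ t - 1 = card (UNIV - {0 :: 'a})" by (simp add: card_UNIV)
  also have "\<dots> = (\<Sum>z\<in>?I. card {x \<in> UNIV - {0}. ?f x = z})"
    using sum.image_gen[of "UNIV - {0}" "\<lambda>_. 1::nat" ?f] by simp
  also have "\<dots> \<le> (\<Sum>z\<in>?I. q - 1)" by (intro sum_mono fib)
  also have "\<dots> = card ?I * (q - 1)" by simp
  finally have "?m * (q - 1) \<le> card ?I * (q - 1)" using sum_powers_mult[of q t] q_ge_2 by simp
  then have "?m \<le> card ?I" using q_ge_2 by simp
  moreover have "card ?I \<le> card ?N" by (rule card_mono[OF _ sub]) simp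
  ultimately have eq: "card ?I = card ?N" "card ?N = ?m" using le by simp_all
  show "?N = ?I" using card_subset_eq[OF _ sub eq(1)] by simp
  show "card ?N = ?m" by (rule eq(2))
qed

text \<open>For \<open>s\<close> in \<open>K\<close> every \<open>s ^ (q ^ i)\<close> is
  \<open>s\<close>, so \<open>Norm (a * s + b)\<close> is the value at \<open>s\<close> of the
  polynomial \<open>P a b\<close> of degree \<open>t\<close> with leading coefficient
  \<open>Norm a\<close>. The difference of the two polynomials has degree below \<open>t\<close>,
  hence below \<open>q\<close>, and vanishes on all of \<open>K\<close>; so it is zero and the root
  \<open>- b / a\<close> is shared.\<close>

lemma Norm_linear_eq_imp_conjugate:
  assumes "t \<le> q" "a \<noteq> 0" "c \<noteq> 0"
    and lead: "Norm a = Norm c"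
    and eq: "\<And>s. s \<in> K \<Longrightarrow> Norm (a * s + b) = Norm (c * s + d)"
  shows "- d / c \<in> conjugates (- b / a)"
proof -
  define P where "P = (\<lambda>a b. \<Prod>i<t. [:b ^ (q ^ i), a ^ (q ^ i) :: 'a:])"
  have poly_P: "poly (P a b) x = (\<Prod>i<t. b ^ (q ^ i) + x * a ^ (q ^ i))" for a b x
    by (simp add: P_def poly_prod)
  have poly_K: "poly (P a b) s = Norm (a * s + b)" if "s \<in> K" for a b s
    unfolding poly_P Norm_def using that
    by (intro prod.cong) (simp_all add: frobenius_pow_add power_mult_distrib frobenius_pow_K mult.commute add.commute)
  have deg: "degree (P a b) = t" "coeff (P a b) t = Norm a" if "a \<noteq> 0" for a b
  proof -
    show d: "degree (P a b) = t"
      unfolding P_def using that by (subst degree_prod_eq_sum_degree) auto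
    have "lead_coeff (P a b) = Norm a"
      unfolding P_def Norm_def lead_coeff_prod using that by (intro prod.cong) auto
    then show "coeff (P a b) t = Norm a" using d by simp
  qed
  have "P a b - P c d = 0"
  proof (rule ccontr)
    let ?D = "P a b - P c d"
    assume D: "?D \<noteq> 0"
    have "coeff ?D t = 0" using deg assms by simp
    moreover have "degree ?D \<le> t" using deg assms by (intro degree_diff_le) simp_all
    ultimately have "degree ?D < t"
      using D by (metis le_neq_implies_less leading_coeff_0_iff)
    moreover have "K \<subseteq> {x. poly ?D x = 0}" using eq poly_K by auto
    then have "card K \<le> card {x. poly ?D x = 0}"
      by (rule card_mono[OF poly_roots_finite[OF D]])
    ultimately show False
      using card_poly_roots_bound[OF D] card_K assms(1) by simp
  qed
  \<comment> \<open>The factor of index 0 is the original linear form, which vanishes at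
    \<open>- b / a\<close>.\<close>
  moreover have "poly (P a b) (- b / a) = 0"
    unfolding poly_P using t_pos assms(2) by (intro prod_zero) (auto intro!: bexI[of _ 0])
  ultimately have "poly (P c d) (- b / a) = 0" by simp
  then obtain i where i: "i < t" "d ^ (q ^ i) + (- b / a) * c ^ (q ^ i) = 0"
    unfolding poly_P by auto
  then have "(- b / a) * c ^ (q ^ i) = - (d ^ (q ^ i))" by (simp add: eq_neg_iff_add_eq_0 add.commute)
  then have "- b / a = - (d ^ (q ^ i)) / c ^ (q ^ i)" using assms(3) by (simp add: eq_divide_eq)
  also have "\<dots> = (- d / c) ^ (q ^ i)" by (simp only: power_divide frobenius_pow_minus)
  \<comment> \<open>So far \<open>- b / a\<close> is a conjugate of \<open>- d / c\<close>. The
    complementary power \<open>q ^ (t - i)\<close> reverses this, since the power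
    \<open>q ^ t\<close> is the identity.\<close>
  finally have "(- b / a) ^ (q ^ (t - i)) = (- d / c) ^ (q ^ t)"
    using i(1) by (simp flip: power_mult power_add)
  then show ?thesis unfolding conjugates_def by (metis power_q_t rangeI)
qed

section \<open>Sublines and the pseudoregulus\<close>

definition std_subline :: "('a \<times> 'a) set set" where
  "std_subline = {proj_point a b | a b. a \<in> K \<and> b \<in> K \<and> (a, b) \<noteq> (0, 0)}"

definition std_pseudoregulus :: "('a \<times> 'a) set set" where
  "std_pseudoregulus = {proj_point x (x ^ q) | x. x \<noteq> 0}"

lemma act_std_subline_subset_iff:
  "act (lin_map a b c d) std_subline \<subseteq> T \<longleftrightarrow>
    (\<forall>k\<in>K. \<forall>l\<in>K. (k, l) \<noteq> (0, 0) \<longrightarrow> proj_point (a * k + b * l) (c * k + d * l) \<in> T)"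
  unfolding act_def image_subset_iff std_subline_def lin_map_image_proj_point[symmetric] by blast

text \<open>The right-hand side includes the point at infinity \<open>u = 0\<close>, because \<open>v / 0 = 0\<close>.\<close>

lemma proj_point_in_std_subline_iff:
  assumes "(u, v) \<noteq> (0, 0)"
  shows "proj_point u v \<in> std_subline \<longleftrightarrow> v / u \<in> K"
proof
  assume "proj_point u v \<in> std_subline"
  then obtain k l where kl: "proj_point u v = proj_point k l" "k \<in> K" "l \<in> K" "(k, l) \<noteq> (0, 0)"
    unfolding std_subline_def by blast
  obtain c where "c \<noteq> 0" "k = c * u" "l = c * v"
    using kl(1) unfolding proj_point_eq_iff[OF assms kl(4)] by blast
  then have "v / u = l / k" by simp
  then show "v / u \<in> K" using K_closed(7)[OF kl(3) kl(2)] by simp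
next
  assume uv: "v / u \<in> K"
  have std: "proj_point k l \<in> std_subline" if "k \<in> K" "l \<in> K" "(k, l) \<noteq> (0, 0)" for k l
    unfolding std_subline_def using that by blast
  show "proj_point u v \<in> std_subline"
  proof (cases "u = 0")
    case True
    then have "1 / v \<noteq> 0 \<and> 0 = 1 / v * u \<and> 1 = 1 / v * v" using assms by auto
    then have "proj_point u v = proj_point 0 1"
      by (subst proj_point_eq_iff[OF assms]) (simp, rule exI)
    then show ?thesis using std[OF K_closed(1,2)] by simp
  next
    case False
    then have "1 / u \<noteq> 0 \<and> 1 = 1 / u * u \<and> v / u = 1 / u * v" by simp
    then have "proj_point u v = proj_point 1 (v / u)"
      by (subst proj_point_eq_iff[OF assms]) (simp, rule exI)
    then show ?thesis using std[OF K_closed(2) uv] by simp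
  qed
qed

text \<open>The slope of (x, x^q) is \<open>x ^ (q - 1)\<close>, and by
  \<open>Norm_1_eq_powers\<close> such slopes are exactly the elements of norm 1.\<close>

lemma proj_point_in_std_pseudoregulus_iff:
  assumes "(u, v) \<noteq> (0, 0)"
  shows "proj_point u v \<in> std_pseudoregulus \<longleftrightarrow> u \<noteq> 0 \<and> v \<noteq> 0 \<and> Norm u = Norm v"
proof
  assume "proj_point u v \<in> std_pseudoregulus"
  then obtain x where x: "proj_point u v = proj_point x (x ^ q)" "x \<noteq> 0"
    unfolding std_pseudoregulus_def by blast
  then have "(x, x ^ q) \<noteq> (0, 0)" by simp
  then obtain c where c: "c \<noteq> 0" "x = c * u" "x ^ q = c * v"
    using x(1) proj_point_eq_iff[OF assms] by metis
  then have "Norm c * Norm u = Norm c * Norm v" by (metis Norm_mult Norm_power_q)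
  moreover have "u \<noteq> 0" using c(2) x(2) by auto
  moreover have "v \<noteq> 0"
  proof
    assume "v = 0"
    then have "x ^ q = 0" using c(3) by simp
    then show False using x(2) by simp
  qed
  ultimately show "u \<noteq> 0 \<and> v \<noteq> 0 \<and> Norm u = Norm v"
    using c(1) by (simp add: Norm_eq_0_iff)
next
  assume uv: "u \<noteq> 0 \<and> v \<noteq> 0 \<and> Norm u = Norm v"
  then have "v / u \<in> {z. Norm z = 1}" by (simp add: Norm_divide Norm_eq_0_iff)
  then obtain x where x: "x \<noteq> 0" "v / u = x ^ (q - 1)" unfolding Norm_1_eq_powers by blast
  have "x ^ q = x * x ^ (q - 1)" using q_ge_2 by (simp add: power_eq_if)
  also have "\<dots> = x / u * v" unfolding x(2)[symmetric] by simp
  finally have "x / u \<noteq> 0 \<and> x = x / u * u \<and> x ^ q = x / u * v" using uv x(1) by simp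
  then have "proj_point u v = proj_point x (x ^ q)"
    using x(1) by (subst proj_point_eq_iff[OF assms]) (simp, rule exI)
  then show "proj_point u v \<in> std_pseudoregulus"
    using x(1) unfolding std_pseudoregulus_def by blast
qed

section \<open>Counting the stabilizer and the maps into the pseudoregulus\<close>

lemma card_nonzero: "card (UNIV - {0 :: 'a}) = q ^ t - 1"
  by (simp add: card_UNIV)

lemma card_K_nonzero: "card (K - {0}) = q - 1"
  using K_closed(1) card_K by simp

text \<open>The maps are the nonzero scalar multiples of matrices of GL(2, K). To count each once,
  the first nonzero entry of the top row is taken out as the scalar \<open>g\<close>.\<close>

lemma card_stabilizer:
  "card {f \<in> GL2. act f std_subline \<subseteq> std_subline} = (q ^ t - 1) * (q - 1) * q * (q + 1)"
proof -
  \<comment> \<open>After removal of \<open>g\<close>, the rows are (1, x) and (m, m x + e), so that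
    \<open>e\<close> is the determinant. In \<open>h2\<close> they are (0, 1) and (e, n), with
    determinant \<open>- e\<close>.\<close>
  define h1 where "h1 = (\<lambda>(g :: 'a, x, m, e). lin_map g (g * x) (g * m) (g * (m * x + e)))"
  define h2 where "h2 = (\<lambda>(g :: 'a, e, n). lin_map 0 g (g * e) (g * n))"
  let ?D1 = "(UNIV - {0 :: 'a}) \<times> K \<times> K \<times> (K - {0})"
  let ?D2 = "(UNIV - {0 :: 'a}) \<times> (K - {0}) \<times> K"
  let ?Stab = "{f \<in> GL2. act f std_subline \<subseteq> std_subline}"
  have scaled: "lin_map (g * a) (g * b) (g * c) (g * d) \<in> ?Stab"
    if "g \<noteq> 0" "a \<in> K" "b \<in> K" "c \<in> K" "d \<in> K" and det: "a * d - b * c \<noteq> 0" for g a b c d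
  proof -
    have "(g * a) * (g * d) - (g * b) * (g * c) = g * g * (a * d - b * c)"
      by (simp add: algebra_simps)
    then have det': "(g * a) * (g * d) - (g * b) * (g * c) \<noteq> 0" using that(1) det by simp
    have "proj_point (g * a * k + g * b * l) (g * c * k + g * d * l) \<in> std_subline"
      if kl: "k \<in> K" "l \<in> K" "(k, l) \<noteq> (0, 0)" for k l
    proof -
      have "(g * c * k + g * d * l) / (g * a * k + g * b * l) = (g * (c * k + d * l)) / (g * (a * k + b * l))"
        by (simp add: algebra_simps)
      also have "\<dots> = (c * k + d * l) / (a * k + b * l)" using \<open>g \<noteq> 0\<close> by simp
      also have "\<dots> \<in> K" using that kl \<open>a \<in> K\<close> \<open>b \<in> K\<close> \<open>c \<in> K\<close> \<open>d \<in> K\<close> by (intro K_closed)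
      finally show ?thesis
        using proj_point_in_std_subline_iff[OF lin_map_nonzero[OF det' kl(3)]] by simp
    qed
    then show ?thesis using det' by (auto simp: act_std_subline_subset_iff lin_map_in_GL2_iff)
  qed
  have "?Stab = h1 ` ?D1 \<union> h2 ` ?D2"
  proof (intro equalityI subsetI)
    fix f assume "f \<in> ?Stab"
    then obtain a b c d where f: "f = lin_map a b c d" and det: "a * d - b * c \<noteq> 0"
      and sub: "act (lin_map a b c d) std_subline \<subseteq> std_subline"
      unfolding GL2_def by blast
    have "(c * k + d * l) / (a * k + b * l) \<in> K"
      if "k \<in> K" "l \<in> K" "(k, l) \<noteq> (0, 0)" for k l
      using sub that proj_point_in_std_subline_iff[OF lin_map_nonzero[OF det that(3)]]
      unfolding act_std_subline_subset_iff by blast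
    \<comment> \<open>A projectivity is determined by the images of a frame of three points, so the
      slopes of these images should force all ratios of entries into \<open>K\<close>.\<close>
    from this[of 1 0] this[of 0 1] this[of 1 1]
    have ca: "c / a \<in> K" and db: "d / b \<in> K" and cd: "(c + d) / (a + b) \<in> K"
      using K_closed(1,2) by simp_all
    show "f \<in> h1 ` ?D1 \<union> h2 ` ?D2"
    proof (cases "a = 0")
      case True
      then have b: "b \<noteq> 0" "c \<noteq> 0" using det by auto
      have "c / b = (c + d) / (a + b) - d / b" using True b by (simp add: add_divide_distrib)
      then have "c / b \<in> K" using cd db K_closed(6) by simp
      then have "(b, c / b, d / b) \<in> ?D2" using b db by simp
      moreover have "f = h2 (b, c / b, d / b)" using b True by (simp add: h2_def f)
      ultimately show ?thesis by blast
    next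
      case a: False
      have K_ba: "b / a \<in> K \<and> d / a \<in> K"
      proof (cases "b = 0")
        case True
        \<comment> \<open>Here \<open>d / b\<close> is 0 by convention and carries no information;
          the third slope yields \<open>d / a\<close> instead.\<close>
        have "d / a = (c + d) / (a + b) - c / a" using True by (simp add: add_divide_distrib)
        then have "d / a \<in> K" using ca cd K_closed(6) by simp
        then show ?thesis using True K_closed(1) by simp
      next
        case b: False
        have ba: "b / a \<in> K"
        proof (cases "a + b = 0")
          case True
          then have "b = - a" by (simp add: eq_neg_iff_add_eq_0 add.commute)
          then show ?thesis using a K_closed(2,5) by simp
        next
          case ab: False
          \<comment> \<open>Substituting the first two slopes into the third gives a linear relation
            between \<open>a\<close> and \<open>b\<close> over \<open>K\<close>. It can be solved
            for \<open>b / a\<close> because \<open>n = k\<close> would make all three slopes equal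
            and the determinant zero.\<close>
          define m n k where "m = c / a" and "n = d / b" and "k = (c + d) / (a + b)"
          have cdk: "c = m * a" "d = n * b" "c + d = k * (a + b)"
            using a b ab by (simp_all add: m_def n_def k_def)
          then have eq: "(k - m) * a = (n - k) * b" by (simp add: algebra_simps)
          have "n \<noteq> k"
          proof
            assume "n = k"
            then have "m = k" using eq a by simp
            then show False using cdk \<open>n = k\<close> det by (simp add: algebra_simps)
          qed
          then have "b / a = (k - m) / (n - k)" using eq a by (simp add: field_simps)
          then show ?thesis using ca db cd K_closed(6,7) by (simp add: m_def n_def k_def)
        qed
        moreover have "d / a = d / b * (b / a)" using b by simp
        ultimately show ?thesis using db K_closed(4) by metis
      qed
      let ?e = "d / a - c / a * (b / a)"
      have "?e \<in> K" using K_ba ca K_closed(4,6) by blast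
      moreover have "?e \<noteq> 0"
      proof
        assume "?e = 0"
        moreover have "a * a * ?e = a * d - b * c" using a by (simp add: field_simps)
        ultimately show False using det by (metis mult_zero_right)
      qed
      ultimately have "(a, b / a, c / a, ?e) \<in> ?D1" using a K_ba ca by simp
      moreover have "f = h1 (a, b / a, c / a, ?e)" using a by (simp add: h1_def f lin_map_inject)
      ultimately show ?thesis by blast
    qed
  next
    fix f assume "f \<in> h1 ` ?D1 \<union> h2 ` ?D2"
    then consider g x m e where "g \<noteq> 0" "x \<in> K" "m \<in> K" "e \<in> K" "e \<noteq> 0"
        "f = lin_map g (g * x) (g * m) (g * (m * x + e))"
      | g e n where "g \<noteq> 0" "e \<in> K" "e \<noteq> 0" "n \<in> K" "f = lin_map 0 g (g * e) (g * n)"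
      unfolding h1_def h2_def by fastforce
    then show "f \<in> ?Stab"
    proof cases
      case 1
      then show ?thesis using scaled[of g 1 x m "m * x + e"] K_closed(2-4) by simp
    next
      case 2
      then show ?thesis using scaled[of g 0 1 e n] K_closed(1,2) by simp
    qed
  qed
  moreover have "inj_on h1 ?D1" "inj_on h2 ?D2"
    by (auto simp: h1_def h2_def inj_on_def lin_map_inject)
  moreover have "h1 ` ?D1 \<inter> h2 ` ?D2 = {}"
    by (auto simp: h1_def h2_def lin_map_inject)
  ultimately have "card ?Stab = card ?D1 + card ?D2"
    by (simp add: card_Un_disjoint card_image)
  also have "\<dots> = (q ^ t - 1) * (q * (q * (q - 1))) + (q ^ t - 1) * ((q - 1) * q)"
    by (simp only: card_cartesian_product card_nonzero card_K_nonzero card_K)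
  also have "m * (q * (q * n)) + m * (n * q) = m * n * q * (q + 1)" for m n
    by (simp add: algebra_simps)
  finally show ?thesis .
qed

text \<open>The maps correspond to a scalar \<open>a\<close>, a norm-one \<open>u\<close> and an
  ordered pair of distinct conjugates \<open>y\<close>, \<open>y'\<close>; (s, 1) goes to (a (s -
  y), a u (s - y')).\<close>

lemma card_maps_into_std_pseudoregulus:
  assumes "t \<le> q"
  shows "card {f \<in> GL2. act f std_subline \<subseteq> std_pseudoregulus} =
    (q ^ t - 1) * (\<Sum>i<t. q ^ i) * (\<Sum>y\<in>UNIV - K. adjoin_degree K y - 1)"
proof -
  define h where "h = (\<lambda>(a :: 'a, u, y, y'). lin_map a (- (a * y)) (a * u) (- (a * u * y')))"
  let ?D = "(UNIV - {0 :: 'a}) \<times> {z. Norm z = 1} \<times> (SIGMA y:UNIV. conjugates y - {y})"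
  let ?A = "{f \<in> GL2. act f std_subline \<subseteq> std_pseudoregulus}"
  have "?A = h ` ?D"
  proof (intro equalityI subsetI)
    fix f assume "f \<in> ?A"
    then obtain a b c d where f: "f = lin_map a b c d" and det: "a * d - b * c \<noteq> 0"
      and sub: "act (lin_map a b c d) std_subline \<subseteq> std_pseudoregulus"
      unfolding GL2_def by blast
    have *: "a * k + b * l \<noteq> 0 \<and> c * k + d * l \<noteq> 0 \<and> Norm (a * k + b * l) = Norm (c * k + d * l)"
      if "k \<in> K" "l \<in> K" "(k, l) \<noteq> (0, 0)" for k l
      using sub that proj_point_in_std_pseudoregulus_iff[OF lin_map_nonzero[OF det that(3)]]
      unfolding act_std_subline_subset_iff by blast
    \<comment> \<open>The point (1, 0) gives equality of the leading norms; the points (s, 1) then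
      give the norm identity on \<open>K\<close>.\<close>
    from *[of 1 0] have ac: "a \<noteq> 0" "c \<noteq> 0" "Norm a = Norm c" using K_closed(1,2) by simp_all
    have "- d / c \<in> conjugates (- b / a)"
    proof (rule Norm_linear_eq_imp_conjugate[OF assms ac])
      show "Norm (a * s + b) = Norm (c * s + d)" if "s \<in> K" for s
        using *[OF that K_closed(2)] by simp
    qed
    moreover have "- d / c \<noteq> - b / a"
    proof
      assume "- d / c = - b / a"
      then have "d / c = b / a" by (simp only: minus_divide_left[symmetric] neg_equal_iff_equal)
      then have "d * a = b * c" using ac(1,2) by (simp add: frac_eq_eq)
      then show False using det by (simp add: mult.commute)
    qed
    moreover have "Norm (c / a) = 1" using ac by (simp add: Norm_divide Norm_eq_0_iff)
    ultimately have "(a, c / a, - b / a, - d / c) \<in> ?D" using ac(1) by simp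
    moreover have "f = h (a, c / a, - b / a, - d / c)"
      using ac(1,2) by (simp add: h_def f lin_map_inject)
    ultimately show "f \<in> h ` ?D" by (rule rev_image_eqI)
  next
    fix f assume "f \<in> h ` ?D"
    then obtain v where v: "v \<in> ?D" "f = h v" by blast
    obtain a u y y' where "v = (a, u, y, y')" by (metis prod_cases4)
    then have a: "a \<noteq> 0" "Norm u = 1" and y: "y' \<in> conjugates y" "y' \<noteq> y"
      and f: "f = lin_map a (- (a * y)) (a * u) (- (a * u * y'))"
      using v by (simp_all add: h_def)
    have "u \<noteq> 0" using a(2) Norm_eq_0_iff[of u] by auto
    \<comment> \<open>An element of \<open>K\<close> is its own only conjugate. Hence
      \<open>k - y * l\<close> cannot vanish below, as \<open>y\<close> would be the quotient
      \<open>k / l\<close>.\<close>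
    have "y \<notin> K" using y conjugates_K by blast
    obtain i where i: "y' = y ^ (q ^ i)" using y(1) unfolding conjugates_def by blast
    have "a * (- (a * u * y')) - (- (a * y)) * (a * u) = a * a * u * (y - y')"
      by (simp add: algebra_simps)
    then have det: "a * (- (a * u * y')) - (- (a * y)) * (a * u) \<noteq> 0"
      using a(1) \<open>u \<noteq> 0\<close> y(2) by simp
    have "proj_point (a * k + - (a * y) * l) (a * u * k + - (a * u * y') * l) \<in> std_pseudoregulus"
      if kl: "k \<in> K" "l \<in> K" "(k, l) \<noteq> (0, 0)" for k l
    proof -
      have e1: "a * k + - (a * y) * l = a * (k - y * l)" by (simp add: algebra_simps)
      \<comment> \<open>Frobenius powers fix \<open>k\<close> and \<open>l\<close>, so the two
        linear forms take conjugate values, which have equal norm.\<close>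
      have "k - y' * l = (k - y * l) ^ (q ^ i)"
        using kl by (simp add: i frobenius_pow_diff power_mult_distrib frobenius_pow_K)
      moreover have "a * u * k + - (a * u * y') * l = a * u * (k - y' * l)"
        by (simp add: algebra_simps)
      ultimately have e2: "a * u * k + - (a * u * y') * l = a * u * (k - y * l) ^ (q ^ i)" by simp
      have "k - y * l \<noteq> 0"
      proof
        assume "k - y * l = 0"
        moreover from this have "l \<noteq> 0" using kl(3) by auto
        ultimately have "y = k / l" by (simp add: field_simps)
        then show False using \<open>y \<notin> K\<close> K_closed(7) kl by blast
      qed
      then have "a * k + - (a * y) * l \<noteq> 0 \<and> a * u * k + - (a * u * y') * l \<noteq> 0 \<and>
          Norm (a * k + - (a * y) * l) = Norm (a * u * k + - (a * u * y') * l)"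
        unfolding e1 e2 using a \<open>u \<noteq> 0\<close> by (simp add: Norm_mult Norm_power_q_pow)
      then show ?thesis
        using proj_point_in_std_pseudoregulus_iff[OF lin_map_nonzero[OF det kl(3)]] by simp
    qed
    then show "f \<in> ?A" unfolding f using det by (auto simp: act_std_subline_subset_iff lin_map_in_GL2_iff)
  qed
  moreover have "inj_on h ?D"
  proof (rule inj_onI)
    fix v w assume v: "v \<in> ?D" and w: "w \<in> ?D" and eq: "h v = h w"
    obtain a u y y' where va: "v = (a, u, y, y')" by (metis prod_cases4)
    obtain b z x x' where wb: "w = (b, z, x, x')" by (metis prod_cases4)
    have "a \<noteq> 0" "Norm u = 1" using v va by simp_all
    then have "u \<noteq> 0" using Norm_eq_0_iff[of u] by simp
    have "a = b" "a * y = b * x" "a * u = b * z" "a * u * y' = b * z * x'"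
      using eq unfolding h_def va wb prod.case lin_map_inject neg_equal_iff_equal by blast+
    then show "v = w" using \<open>a \<noteq> 0\<close> \<open>u \<noteq> 0\<close> by (simp add: va wb)
  qed
  ultimately have "card ?A = card ?D" by (simp add: card_image)
  also have "\<dots> = (q ^ t - 1) * ((\<Sum>i<t. q ^ i) * card (SIGMA y:UNIV. conjugates y - {y}))"
    by (simp only: card_cartesian_product card_nonzero card_Norm_1)
  also have "card (SIGMA y:UNIV. conjugates y - {y}) = (\<Sum>y\<in>UNIV. adjoin_degree K y - 1)"
    using self_in_conjugates by (simp add: card_conjugates)
  \<comment> \<open>Elements of \<open>K\<close> have degree 1 and contribute 0.\<close>
  also have "\<dots> = (\<Sum>y\<in>UNIV - K. adjoin_degree K y - 1)"
  proof (rule sum.mono_neutral_right)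
    show "\<forall>y\<in>UNIV - (UNIV - K). adjoin_degree K y - 1 = 0"
      using conjugates_K by (auto simp flip: card_conjugates)
  qed auto
  finally show ?thesis by (simp only: mult.assoc)
qed

text \<open>Orbit counting with the two cardinalities above, after cancelling the
  \<open>q ^ t - 1\<close> scalars. Over the naturals the quotient is kept as a product.\<close>

lemma card_sublines_in_pseudoregulus:
  assumes "t \<le> q" and "pseudoregulus_type q L"
  shows "card {S. subline K S \<and> S \<subseteq> L} * ((q - 1) * q * (q + 1)) =
    (\<Sum>i<t. q ^ i) * (\<Sum>y\<in>UNIV - K. adjoin_degree K y - 1)"
proof -
  have B: "std_subline \<subseteq> proj_line" unfolding proj_line_def std_subline_def by blast
  obtain g where g: "g \<in> GL2" "L = act g std_pseudoregulus"
    using assms(2) unfolding pseudoregulus_type_def proj_equivalent_iff std_pseudoregulus_def by blast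
  define ns sd where "ns = card {S. subline K S \<and> S \<subseteq> L}"
    and "sd = (\<Sum>y\<in>UNIV - K. adjoin_degree K y - 1)"
  have "ns * ((q ^ t - 1) * (q - 1) * q * (q + 1)) = (q ^ t - 1) * (\<Sum>i<t. q ^ i) * sd"
    using card_orbit_in_translate[OF g(1), of std_subline std_pseudoregulus] B
    unfolding ns_def sd_def subline_def std_subline_def[symmetric] proj_equivalent_iff g(2)
      card_stabilizer card_maps_into_std_pseudoregulus[OF assms(1)]
    by (simp only: simp_thms)
  then have "(q ^ t - 1) * (ns * ((q - 1) * q * (q + 1))) = (q ^ t - 1) * ((\<Sum>i<t. q ^ i) * sd)"
    by (simp only: ac_simps)
  moreover have "q ^ t - 1 \<noteq> 0"
    using one_less_power[of q t] q_ge_2 t_pos by simp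
  ultimately have "ns * ((q - 1) * q * (q + 1)) = (\<Sum>i<t. q ^ i) * sd"
    by (simp only: nat_mult_eq_cancel_disj simp_thms)
  then show ?thesis unfolding ns_def sd_def .
qed

text \<open>Ensures that the natural subtraction \<open>adjoin_degree K y - 1\<close> is a true one
  when passing to the reals.\<close>

lemma adjoin_degree_pos: "adjoin_degree K y > 0"
  using self_in_conjugates[of y] by (auto simp: card_gt_0_iff simp flip: card_conjugates)

end

section \<open>The formula over the reals\<close>

theorem theorem4p8:
  fixes q t :: nat
    and K :: "'a::{field, finite} set"
    and L :: "('a \<times> 'a) set set"
  assumes "t \<ge> 3" and "q \<ge> t"
    and "CARD('a) = q ^ t"
    and "subfield K (ring_of_type_algebra :: 'a ring)" and "card K = q"
    and "pseudoregulus_type q L"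
  shows "real (card {S. subline K S \<and> S \<subseteq> L}) =
    theta q (t - 1) / (real q + 1) *
      ((\<Sum>y\<in>UNIV - K. real (adjoin_degree K y)) / (real q * (real q - 1)) - theta q (t - 2))"
proof -
  interpret finite_field_extension K q t
    using assms by (intro finite_field_extension.intro)
  define n D where "n = real (card {S. subline K S \<and> S \<subseteq> L})"
    and "D = (\<Sum>y\<in>UNIV - K. real (adjoin_degree K y))"
  have q: "real q > 1" using q_ge_2 by simp
  have t: "t - 1 + 1 = t" "t - 2 + 1 = t - 1" "real q ^ t = real q * real q ^ (t - 1)"
    using assms(1) by (simp_all add: power_eq_if)
  have "real (\<Sum>i<t. q ^ i) * (real q - 1) = real q ^ t - 1"
    by (simp add: power_diff_1_eq mult.commute)
  then have theta: "real (\<Sum>i<t. q ^ i) = theta q (t - 1)"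
    unfolding theta_def t(1) using q by (simp add: eq_divide_eq)
  \<comment> \<open>The summands -1 over the \<open>q ^ t - q\<close> elements outside
    \<open>K\<close> add up to \<open>- q * (q ^ (t - 1) - 1)\<close>; division by
    \<open>q * (q - 1)\<close> turns this into the term \<open>- theta q (t - 2)\<close>.\<close>
  have "card (UNIV - K) = q ^ t - q" by (simp add: card_Diff_subset card_UNIV card_K)
  moreover have "q \<le> q ^ t" using t_pos q_ge_2 by (simp add: self_le_power)
  ultimately have cU: "real (card (UNIV - K)) = real q * (real q ^ (t - 1) - 1)"
    by (simp add: of_nat_diff t(3) algebra_simps)
  have "real (\<Sum>y\<in>UNIV - K. adjoin_degree K y - 1) = (\<Sum>y\<in>UNIV - K. real (adjoin_degree K y) - 1)"
    using adjoin_degree_pos by (simp add: of_nat_diff Suc_le_eq)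
  also have "\<dots> = D - real q * (real q ^ (t - 1) - 1)"
    unfolding D_def sum_subtractf cU[symmetric] by simp
  finally have "n * ((real q - 1) * real q * (real q + 1)) =
      theta q (t - 1) * (D - real q * (real q ^ (t - 1) - 1))"
    using arg_cong[OF card_sublines_in_pseudoregulus[OF assms(2,6)], of real] q_ge_2
    unfolding n_def theta[symmetric] by (simp only: of_nat_mult of_nat_add of_nat_1 of_nat_diff)
  then have "n = theta q (t - 1) * (D - real q * (real q ^ (t - 1) - 1)) /
      ((real q - 1) * real q * (real q + 1))"
    using q by (simp add: eq_divide_eq)
  also have "\<dots> = theta q (t - 1) / (real q + 1) *
      ((D - real q * (real q ^ (t - 1) - 1)) / (real q * (real q - 1)))"
    by (simp add: mult_ac)
  also have "(D - real q * (real q ^ (t - 1) - 1)) / (real q * (real q - 1)) =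
      D / (real q * (real q - 1)) - theta q (t - 2)"
    unfolding theta_def t(2) using q by (simp add: diff_divide_distrib)
  finally show ?thesis unfolding n_def D_def .
qed

end
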